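(* In the single-channel setting of the context, suppose $p_{11}\neq p_{01}$ and the discount factor $\beta\in(0,1)$ satisfies $$\beta \le \begin{cases}\dfrac{1}{2(p_{11}-p_{01})\left[1+\sum_{i\in P}(p_{i,1}-p_{i,0})\right]}, & p_{11}>p_{01},\\[2ex] \dfrac{1}{(p_{01}-p_{11})\left[3+4\sum_{i\in P}(p_{i,1}-p_{i,0})\right]}, & p_{01}>p_{11},\end{cases}$$ where $P=\{i\in\{1,\dots,K\}:p_{i,1}-p_{i,0}\ge0\}$. Then for all $T\ge1$ and $\omega\in(0,1)$, $$V'_{1,T,\beta,m}(\omega;a=1)\ge V'_{1,T,\beta,m}(\omega;a=0),$$ where $V'_{1,T,\beta,m}(\omega;a=k)$ denotes the right derivative of $V_{1,T,\beta,m}(\,\cdot\,;a=k)$ at $\omega$, for $k\in\{0,1\}$.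
   Context: $p_{01},p_{11}\in[0,1]$ are transition probabilities of a two-state Markov chain on $\{0,1\}$ ($p_{01}$: from $0$ to $1$; $p_{11}$: from $1$ to $1$); $K\ge1$; $(p_{i,1})_{i=1}^K$ and $(p_{i,0})_{i=1}^K$ are probability vectors; $m\in\mathbb R$ is a fixed subsidy. For $\omega\in[0,1]$ put $\mathcal T(\omega)=p_{11}\omega+p_{01}(1-\omega)$ and $$\omega_i=\frac{p_{11}p_{i,1}\omega+p_{01}p_{i,0}(1-\omega)}{p_{i,1}\omega+p_{i,0}(1-\omega)}.$$ The $T$-horizon value function $V_{1,T,\beta,m}:[0,1]\to\mathbb R$ (maximal expected total $\beta$-discounted reward over $T$ steps, with expected reward $\omega$ when active and $m$ when passive) is given by $V_{1,0,\beta,m}\equiv0$ and, for $T\ge1$, $V_{1,T,\beta,m}(\omega)=\max\{V_{1,T,\beta,m}(\omega;a=0),V_{1,T,\beta,m}(\omega;a=1)\}$ with $$V_{1,T,\beta,m}(\omega;a=0)=m+\beta V_{1,T-1,\beta,m}(\mathcal T(\omega)),$$ $$V_{1,T,\beta,m}(\omega;a=1)=\omega+\beta\sum_{i=1}^K[p_{i,1}\omega+p_{i,0}(1-\omega)]\,V_{1,T-1,\beta,m}(\omega_i),$$ where summands with $p_{i,1}\omega+p_{i,0}(1-\omega)=0$ are read as $0$. These functions are piecewise linear in $\omega$, so one-sided derivatives exist. *)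

theory Defs
  imports Complex_Main
begin

definition prob_vector :: "nat \<Rightarrow> (nat \<Rightarrow> real) \<Rightarrow> bool" where
  "prob_vector K p \<longleftrightarrow> (\<forall>i\<in>{1..K}. 0 \<le> p i) \<and> (\<Sum>i=1..K. p i) = 1"

definition belief_step :: "real \<Rightarrow> real \<Rightarrow> real \<Rightarrow> real" where
  "belief_step p01 p11 w = p11 * w + p01 * (1 - w)"

text \<open>
  Below, \<open>q1 i\<close> and \<open>q0 i\<close> are the probabilities of observing
  \<open>i \<in> {1..K}\<close> when the state of the chain is 1 and 0, respectively.
\<close>

definition obs_prob :: "(nat \<Rightarrow> real) \<Rightarrow> (nat \<Rightarrow> real) \<Rightarrow> real \<Rightarrow> nat \<Rightarrow> real" where
  "obs_prob q1 q0 w i = q1 i * w + q0 i * (1 - w)"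

definition belief_update ::
  "real \<Rightarrow> real \<Rightarrow> (nat \<Rightarrow> real) \<Rightarrow> (nat \<Rightarrow> real) \<Rightarrow> real \<Rightarrow> nat \<Rightarrow> real" where
  "belief_update p01 p11 q1 q0 w i =
     (p11 * q1 i * w + p01 * q0 i * (1 - w)) / obs_prob q1 q0 w i"

text \<open>
  One step of the Bellman recursion, for a continuation value \<open>W\<close>.  A summand with
  \<open>obs_prob q1 q0 w i = 0\<close> vanishes, whatever \<open>W\<close> is at the junk value of
  \<open>belief_update\<close>.  All arguments passed to \<open>W\<close> otherwise lie in the interval
  \<open>[0, 1]\<close> if \<open>w\<close> does, so the values outside this interval are irrelevant.
\<close>

definition passive_step ::
  "real \<Rightarrow> real \<Rightarrow> real \<Rightarrow> real \<Rightarrow> (real \<Rightarrow> real) \<Rightarrow> real \<Rightarrow> real" where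
  "passive_step p01 p11 m \<beta> W w = m + \<beta> * W (belief_step p01 p11 w)"

definition active_step ::
  "real \<Rightarrow> real \<Rightarrow> nat \<Rightarrow> (nat \<Rightarrow> real) \<Rightarrow> (nat \<Rightarrow> real) \<Rightarrow> real
     \<Rightarrow> (real \<Rightarrow> real) \<Rightarrow> real \<Rightarrow> real" where
  "active_step p01 p11 K q1 q0 \<beta> W w =
     w + \<beta> * (\<Sum>i=1..K. obs_prob q1 q0 w i * W (belief_update p01 p11 q1 q0 w i))"

primrec V ::
  "real \<Rightarrow> real \<Rightarrow> nat \<Rightarrow> (nat \<Rightarrow> real) \<Rightarrow> (nat \<Rightarrow> real) \<Rightarrow> real \<Rightarrow> real
     \<Rightarrow> nat \<Rightarrow> real \<Rightarrow> real" where
  "V p01 p11 K q1 q0 m \<beta> 0 = (\<lambda>w. 0)"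
| "V p01 p11 K q1 q0 m \<beta> (Suc T) =
     (\<lambda>w. max (passive_step p01 p11 m \<beta> (V p01 p11 K q1 q0 m \<beta> T) w)
              (active_step p01 p11 K q1 q0 \<beta> (V p01 p11 K q1 q0 m \<beta> T) w))"

text \<open>
  \<open>V_passive\<close> and \<open>V_active\<close> are the values \<open>V(\<omega>; a = 0)\<close> and
  \<open>V(\<omega>; a = 1)\<close> of choosing the given action first; meaningful for \<open>T \<ge> 1\<close> only.
\<close>

definition V_passive ::
  "real \<Rightarrow> real \<Rightarrow> nat \<Rightarrow> (nat \<Rightarrow> real) \<Rightarrow> (nat \<Rightarrow> real) \<Rightarrow> real \<Rightarrow> real
     \<Rightarrow> nat \<Rightarrow> real \<Rightarrow> real" where
  "V_passive p01 p11 K q1 q0 m \<beta> T =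
     passive_step p01 p11 m \<beta> (V p01 p11 K q1 q0 m \<beta> (T - 1))"

definition V_active ::
  "real \<Rightarrow> real \<Rightarrow> nat \<Rightarrow> (nat \<Rightarrow> real) \<Rightarrow> (nat \<Rightarrow> real) \<Rightarrow> real \<Rightarrow> real
     \<Rightarrow> nat \<Rightarrow> real \<Rightarrow> real" where
  "V_active p01 p11 K q1 q0 m \<beta> T =
     active_step p01 p11 K q1 q0 \<beta> (V p01 p11 K q1 q0 m \<beta> (T - 1))"

lemma V_eq_max:
  assumes "T \<ge> 1"
  shows "V p01 p11 K q1 q0 m \<beta> T w =
    max (V_passive p01 p11 K q1 q0 m \<beta> T w) (V_active p01 p11 K q1 q0 m \<beta> T w)"
  using assms by (cases T) (simp_all add: V_passive_def V_active_def)

definition pos_part_sum :: "nat \<Rightarrow> (nat \<Rightarrow> real) \<Rightarrow> (nat \<Rightarrow> real) \<Rightarrow> real" where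
  "pos_part_sum K q1 q0 = (\<Sum>i\<in>{i\<in>{1..K}. q1 i - q0 i \<ge> 0}. q1 i - q0 i)"

end

theory Submission
  imports Defs "HOL-Analysis.Derivative"
begin

text \<open>
  The slopes of the active and the passive value functions can be separated by a constant \<open>s\<close>
  that depends neither on the belief nor on the horizon: all slopes of the active value are at
  least \<open>s\<close>, all slopes of the passive value are at most \<open>s\<close>.

  Write \<open>W\<close> for the continuation value and \<open>f = W \<circ> belief_step p01 p11\<close>.  The belief after
  observing \<open>i\<close> is the Bayesian posterior followed by \<open>belief_step\<close>, so that the two actions have
  the values \<open>m + \<beta> f(\<omega>)\<close> and \<open>\<omega> + \<beta> E(\<omega>)\<close>, where \<open>E(\<omega>)\<close> is the expectation of \<open>f\<close> at the
  random posterior.  Suppose that the slopes of \<open>f\<close> lie between \<open>l \<le> 0\<close> and \<open>u \<ge> 0\<close>, and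
  let \<open>\<Delta> = pos_part_sum K q1 q0\<close> be the total variation distance of the two observation laws.
  Then the slopes of \<open>E\<close> lie between \<open>l (1 + \<Delta>)\<close> and \<open>u (1 + \<Delta>)\<close>
  (\<open>slopes_in_posterior_average\<close>).  Indeed, if \<open>\<omega>\<close> moves, then \<open>E\<close> changes for two reasons.
  The posteriors move, which contributes a factor of at most \<open>1\<close>: the expected speed of the
  posterior is a sum of weighted harmonic means of \<open>q1 i\<close> and \<open>q0 i\<close>, and these are at most the
  corresponding arithmetic means, which sum to \<open>1\<close>.  Moreover the observation law moves
  in the direction \<open>q1 - q0\<close>.  This direction has total mass \<open>0\<close>, so \<open>f\<close> may be replaced by
  its deviation from the value at the prior; observations with \<open>q1 i > q0 i\<close> raise the belief, by
  at most \<open>1 - \<omega>\<close>, the others lower it, by at most \<open>\<omega>\<close>, and each kind has mass \<open>\<Delta>\<close>.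

  Composition with \<open>belief_step\<close> multiplies slopes by \<open>p11 - p01\<close>.  An induction on the horizon
  therefore only needs an interval of slopes that both actions preserve; a maximum of two functions
  preserves it too.  For \<open>p11 > p01\<close> the interval \<open>[0, 2]\<close> works, with the passive slopes in
  \<open>[0, 1]\<close> and the active ones in \<open>[1, 2]\<close>.  For \<open>p11 < p01\<close> the interval \<open>[-1/2, 3/2]\<close> works,
  separated at \<open>1/2\<close> (\<open>slope_separation\<close>).

  The one-sided derivatives exist because one-sided differentiability on the open unit interval is
  preserved by all operations in the recursion: sums, products, maxima, and composition with
  monotone differentiable maps or with a reflection.
\<close>

section \<open>One-sided differentiability\<close>

text \<open>
  Both sides are needed even for a result on right derivatives, since \<open>belief_step p01 p11\<close>
  reverses orientation if \<open>p11 < p01\<close>.  The half-open intervals include the base point so that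
  they are mapped into intervals of the same kind by a monotone function, strict or not.
\<close>

definition one_sided_differentiable :: "(real \<Rightarrow> real) \<Rightarrow> bool" where
  "one_sided_differentiable f \<longleftrightarrow>
     (\<forall>x\<in>{0<..<1}. f differentiable (at x within {x..<1}) \<and> f differentiable (at x within {0<..x}))"

lemma one_sided_differentiableI:
  assumes "\<And>x. x \<in> {0<..<1} \<Longrightarrow> f differentiable (at x)"
  shows "one_sided_differentiable f"
  using assms by (auto simp: one_sided_differentiable_def intro: differentiable_at_withinI)

lemma one_sided_differentiable_cong:
  assumes "one_sided_differentiable f" "\<And>x. x \<in> {0<..<1} \<Longrightarrow> f x = g x"
  shows "one_sided_differentiable g"
  unfolding one_sided_differentiable_def
proof (intro ballI conjI)
  fix x :: real assume x: "x \<in> {0<..<1}"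
  have trans: "g differentiable (at x within S)"
    if "f differentiable (at x within S)" "x \<in> S" "S \<subseteq> {0<..<1}" for S
    by (rule differentiable_transform_within[OF that(1) zero_less_one])
      (use that(2,3) assms(2) in auto)
  show "g differentiable (at x within {x..<1})" "g differentiable (at x within {0<..x})"
    using assms(1) x by (auto simp: one_sided_differentiable_def intro!: trans)
qed

lemma one_sided_differentiable_add:
  assumes "one_sided_differentiable f" "one_sided_differentiable g"
  shows "one_sided_differentiable (\<lambda>x. f x + g x)"
  using assms by (auto simp: one_sided_differentiable_def)

lemma one_sided_differentiable_mult:
  assumes "one_sided_differentiable f" "one_sided_differentiable g"
  shows "one_sided_differentiable (\<lambda>x. f x * g x)"
  using assms by (auto simp: one_sided_differentiable_def)

lemma one_sided_differentiable_sum: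
  assumes "finite A" "\<And>i. i \<in> A \<Longrightarrow> one_sided_differentiable (f i)"
  shows "one_sided_differentiable (\<lambda>x. \<Sum>i\<in>A. f i x)"
  using assms by (auto simp: one_sided_differentiable_def)

lemma one_sided_differentiable_compose_mono:
  assumes f: "one_sided_differentiable f"
    and g: "\<And>x. x \<in> {0<..<1} \<Longrightarrow> g differentiable (at x)"
    and into: "\<And>x. x \<in> {0<..<1} \<Longrightarrow> g x \<in> {0<..<1}"
    and mono: "mono_on {0<..<1} g"
  shows "one_sided_differentiable (\<lambda>x. f (g x))"
  unfolding one_sided_differentiable_def
proof (intro ballI)
  fix x :: real assume x: "x \<in> {0<..<1}"
  have "g ` {x..<1} \<subseteq> {g x..<1}" "g ` {0<..x} \<subseteq> {0<..g x}"
    using x into mono by (auto simp: mono_on_def)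
  with f into[OF x] have "f differentiable (at (g x) within g ` {x..<1})"
      "f differentiable (at (g x) within g ` {0<..x})"
    by (auto simp: one_sided_differentiable_def intro: differentiable_within_subset)
  from this[THEN differentiable_chain_within[OF differentiable_at_withinI[OF g[OF x]]]]
  show "(\<lambda>x. f (g x)) differentiable (at x within {x..<1}) \<and>
      (\<lambda>x. f (g x)) differentiable (at x within {0<..x})"
    by (simp add: o_def)
qed

lemma one_sided_differentiable_reflect:
  assumes f: "one_sided_differentiable f"
  shows "one_sided_differentiable (\<lambda>x. f (1 - x))"
  unfolding one_sided_differentiable_def
proof (intro ballI)
  fix x :: real assume x: "x \<in> {0<..<1}"
  have "(\<lambda>x. 1 - x) ` {x..<1} \<subseteq> {0<..1 - x}" "(\<lambda>x. 1 - x) ` {0<..x} \<subseteq> {1 - x..<1}"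
    by auto
  with f x have *: "f differentiable (at (1 - x) within (\<lambda>x. 1 - x) ` {x..<1})"
      "f differentiable (at (1 - x) within (\<lambda>x. 1 - x) ` {0<..x})"
    by (auto simp: one_sided_differentiable_def intro: differentiable_within_subset)
  have "(\<lambda>x. 1 - x) differentiable (at x within S)" for S
    by simp
  from *[THEN differentiable_chain_within[OF this]]
  show "(\<lambda>x. f (1 - x)) differentiable (at x within {x..<1}) \<and>
      (\<lambda>x. f (1 - x)) differentiable (at x within {0<..x})"
    by (simp add: o_def)
qed

text \<open>
  At a zero of \<open>h\<close>, the difference quotient of \<open>\<bar>h\<bar>\<close> to the right is the absolute value of that
  of \<open>h\<close>, so it converges as well.
\<close>

lemma differentiable_right_abs:
  fixes h :: "real \<Rightarrow> real"
  assumes h: "h differentiable (at x within S)" and S: "S \<subseteq> {x..}"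
  shows "(\<lambda>y. \<bar>h y\<bar>) differentiable (at x within S)"
proof -
  obtain D where D: "(h has_real_derivative D) (at x within S)"
    using h by (auto simp: real_differentiable_def)
  show ?thesis
  proof (cases "h x = 0")
    case True
    have "((\<lambda>y. (h y - h x) / (y - x)) \<longlongrightarrow> D) (at x within S)"
      using D by (simp add: has_field_derivative_iff)
    from tendsto_rabs[OF this]
    have "((\<lambda>y. (\<bar>h y\<bar> - \<bar>h x\<bar>) / (y - x)) \<longlongrightarrow> \<bar>D\<bar>) (at x within S)"
    proof (rule Lim_transform_eventually)
      show "\<forall>\<^sub>F y in at x within S. \<bar>(h y - h x) / (y - x)\<bar> = (\<bar>h y\<bar> - \<bar>h x\<bar>) / (y - x)"
        unfolding eventually_at_topological
        by (rule exI[of _ UNIV]) (use S True in \<open>auto simp: abs_divide\<close>)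
    qed
    then show ?thesis
      by (auto simp: real_differentiable_def has_field_derivative_iff)
  next
    case False
    have "\<exists>D'. (abs has_real_derivative D') (at (h x))"
    proof (cases "0 < h x")
      case True
      have "(abs has_real_derivative 1) (at (h x))"
        by (rule has_field_derivative_transform_within_open[where S = "{0<..}" and f = "\<lambda>z. z"])
          (use True in auto)
      then show ?thesis ..
    next
      case neg: False
      have "(abs has_real_derivative (-1)) (at (h x))"
        by (rule has_field_derivative_transform_within_open[where S = "{..<0}" and f = uminus])
          (use neg False in \<open>auto intro!: derivative_eq_intros\<close>)
      then show ?thesis ..
    qed
    then have "abs differentiable (at (h x) within h ` S)"
      by (auto simp: real_differentiable_def intro: has_field_derivative_at_within)
    from differentiable_chain_within[OF h this] show ?thesis
      by (simp add: o_def)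
  qed
qed

lemma one_sided_differentiable_abs:
  assumes f: "one_sided_differentiable f"
  shows "one_sided_differentiable (\<lambda>x. \<bar>f x\<bar>)"
proof -
  have right: "(\<lambda>y. \<bar>g y\<bar>) differentiable (at x within {x..<1})"
    if "one_sided_differentiable g" "x \<in> {0<..<1}" for g x
    using that by (intro differentiable_right_abs) (auto simp: one_sided_differentiable_def)
  have left: "(\<lambda>y. \<bar>f y\<bar>) differentiable (at x within {0<..x})" if x: "x \<in> {0<..<1}" for x
  proof -
    have im: "(\<lambda>y. 1 - y) ` {0<..x} \<subseteq> {1 - x..<1}"
      by auto
    have "(\<lambda>y. \<bar>f (1 - y)\<bar>) differentiable (at (1 - x) within {1 - x..<1})"
      using right[OF one_sided_differentiable_reflect[OF f], of "1 - x"] x by simp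
    from differentiable_within_subset[OF this im]
    have "(\<lambda>y. \<bar>f (1 - y)\<bar>) \<circ> (\<lambda>y. 1 - y) differentiable (at x within {0<..x})"
      by (intro differentiable_chain_within) auto
    then show ?thesis by (simp add: o_def)
  qed
  show ?thesis
    using right[OF f] left by (auto simp: one_sided_differentiable_def)
qed

lemma one_sided_differentiable_const: "one_sided_differentiable (\<lambda>x. c)"
  by (intro one_sided_differentiableI) simp

text \<open>
  The maximum of two functions is half of the sum of \<open>f + g\<close> and \<open>\<bar>f - g\<bar>\<close>.
\<close>

lemma one_sided_differentiable_max:
  assumes "one_sided_differentiable f" "one_sided_differentiable g"
  shows "one_sided_differentiable (\<lambda>x. max (f x) (g x))"
proof -
  have "one_sided_differentiable (\<lambda>x. (1/2) * (f x + g x + \<bar>f x + (-1) * g x\<bar>))"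
    by (intro one_sided_differentiable_mult one_sided_differentiable_add
        one_sided_differentiable_abs one_sided_differentiable_const assms)
  then show ?thesis
    by (rule one_sided_differentiable_cong) (auto simp: max_def field_simps)
qed

lemma one_sided_differentiable_right_derivative:
  assumes "one_sided_differentiable f" "x \<in> {0<..<1}"
  obtains D where "(f has_real_derivative D) (at_right x)"
proof -
  have "f differentiable (at x within {x..<1})"
    using assms by (auto simp: one_sided_differentiable_def)
  then obtain D where "(f has_real_derivative D) (at x within {x..<1})"
    by (auto simp: real_differentiable_def)
  then have "(f has_real_derivative D) (at x within {x..(x + 1) / 2})"
    by (rule has_field_derivative_subset) (use assms(2) in auto)
  moreover have "at x within {x..(x + 1) / 2} = at_right x"
    using assms(2) by (intro at_within_Icc_at_right) simp
  ultimately show thesis using that by simp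
qed

section \<open>Secant slopes\<close>

text \<open>
  Slopes of secants rather than derivatives: such bounds pass to maxima and compositions without
  a discussion of kinks.  The interval is closed because an observation that is impossible in one
  of the two states moves the belief to an endpoint.
\<close>

definition slopes_in :: "real \<Rightarrow> real \<Rightarrow> (real \<Rightarrow> real) \<Rightarrow> bool" where
  "slopes_in l u f \<longleftrightarrow>
     (\<forall>x y. 0 \<le> x \<longrightarrow> x \<le> y \<longrightarrow> y \<le> 1 \<longrightarrow> l * (y - x) \<le> f y - f x \<and> f y - f x \<le> u * (y - x))"

lemma slopes_inD:
  assumes "slopes_in l u f" "0 \<le> x" "x \<le> y" "y \<le> 1"
  shows "l * (y - x) \<le> f y - f x" "f y - f x \<le> u * (y - x)"
  using assms by (auto simp: slopes_in_def)

lemma slopes_in_cong: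
  assumes "slopes_in l u f" "\<And>x. x \<in> {0..1} \<Longrightarrow> f x = g x"
  shows "slopes_in l u g"
  using assms by (auto simp: slopes_in_def)

lemma slopes_in_mono:
  assumes "slopes_in l u f" "l' \<le> l" "u \<le> u'"
  shows "slopes_in l' u' f"
  unfolding slopes_in_def
proof (intro allI impI)
  fix x y :: real assume xy: "0 \<le> x" "x \<le> y" "y \<le> 1"
  have "l' * (y - x) \<le> l * (y - x)" "u * (y - x) \<le> u' * (y - x)"
    using assms xy by (auto intro: mult_right_mono)
  with slopes_inD[OF assms(1) xy] show "l' * (y - x) \<le> f y - f x \<and> f y - f x \<le> u' * (y - x)"
    by linarith
qed

lemma slopes_in_affine:
  assumes "slopes_in l u f" "0 \<le> c"
  shows "slopes_in (d + c * l) (d + c * u) (\<lambda>x. k + d * x + c * f x)"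
  unfolding slopes_in_def
proof (intro allI impI)
  fix x y :: real assume xy: "0 \<le> x" "x \<le> y" "y \<le> 1"
  have "c * (l * (y - x)) \<le> c * (f y - f x)" "c * (f y - f x) \<le> c * (u * (y - x))"
    using assms(2) slopes_inD[OF assms(1) xy] by (auto intro: mult_left_mono)
  then show "(d + c * l) * (y - x) \<le> k + d * y + c * f y - (k + d * x + c * f x) \<and>
      k + d * y + c * f y - (k + d * x + c * f x) \<le> (d + c * u) * (y - x)"
    by (simp add: algebra_simps)
qed

lemma slopes_in_max:
  assumes f: "slopes_in l u f" and g: "slopes_in l u g"
  shows "slopes_in l u (\<lambda>x. max (f x) (g x))"
  unfolding slopes_in_def
proof (intro allI impI)
  fix x y :: real assume xy: "0 \<le> x" "x \<le> y" "y \<le> 1"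
  show "l * (y - x) \<le> max (f y) (g y) - max (f x) (g x) \<and>
      max (f y) (g y) - max (f x) (g x) \<le> u * (y - x)"
    using slopes_inD[OF f xy] slopes_inD[OF g xy] by (auto simp: max_def)
qed

lemma right_derivative_bounds_of_slopes_in:
  assumes f: "slopes_in l u f" and x: "x \<in> {0<..<1}"
    and D: "(f has_real_derivative D) (at_right x)"
  shows "l \<le> D" "D \<le> u"
proof -
  have lim: "((\<lambda>y. (f y - f x) / (y - x)) \<longlongrightarrow> D) (at_right x)"
    using D by (simp add: has_field_derivative_iff)
  have ev: "\<forall>\<^sub>F y in at_right x. y \<in> {x<..<1}"
    using x by (intro eventually_at_right_real) simp
  have "\<forall>\<^sub>F y in at_right x. l \<le> (f y - f x) / (y - x)"
    using ev by eventually_elim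
      (use slopes_inD(1)[OF f, of x] x in \<open>auto simp: pos_le_divide_eq\<close>)
  then show "l \<le> D"
    by (intro tendsto_lowerbound[OF lim]) auto
  have "\<forall>\<^sub>F y in at_right x. (f y - f x) / (y - x) \<le> u"
    using ev by eventually_elim
      (use slopes_inD(2)[OF f, of x] x in \<open>auto simp: pos_divide_le_eq\<close>)
  then show "D \<le> u"
    by (intro tendsto_upperbound[OF lim]) auto
qed

section \<open>Averaging over Bayesian posteriors\<close>

text \<open>
  Bayes' rule for the prior \<open>w\<close> and an observation of probabilities \<open>a\<close> and \<open>b\<close> in the states 1
  and 0.  If \<open>a\<close> or \<open>b\<close> vanishes, then the quotient is constant in \<open>w\<close> except at one endpoint, where it
  is 0/0; the case distinction extends the constant to that endpoint, which makes the posterior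
  monotone and continuous on all of the closed unit interval.
\<close>

definition posterior :: "real \<Rightarrow> real \<Rightarrow> real \<Rightarrow> real" where
  "posterior a b w = (if a = 0 then 0 else if b = 0 then 1 else a * w / (a * w + b * (1 - w)))"

lemma obs_pos:
  fixes a b w :: real
  assumes "0 < a" "0 < b" "w \<in> {0..1}"
  shows "0 < a * w + b * (1 - w)"
  using assms by (cases "w = 0") (auto intro: add_pos_nonneg)

lemma posterior_in:
  assumes "0 \<le> a" "0 \<le> b" "w \<in> {0..1}"
  shows "posterior a b w \<in> {0..1}"
  using assms obs_pos[of a b w] by (auto simp: posterior_def)

lemma posterior_in_open:
  assumes "0 < a" "0 < b" "w \<in> {0<..<1}"
  shows "posterior a b w \<in> {0<..<1}"
  using assms obs_pos[of a b w] by (auto simp: posterior_def)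

text \<open>
  For positive \<open>a\<close> and \<open>b\<close>, the left-hand side of the second claim equals
  \<open>(y - x) a b / (a y + b (1 - y))\<close>.  The factor of \<open>y - x\<close> is a weighted harmonic mean of \<open>a\<close> and
  \<open>b\<close>, and the bound is their arithmetic mean with the same weights.
\<close>

lemma posterior_increment:
  assumes ab: "0 \<le> a" "0 \<le> b" and xy: "0 \<le> x" "x \<le> y" "y \<le> 1"
  shows "posterior a b x \<le> posterior a b y"
    and "(a * x + b * (1 - x)) * (posterior a b y - posterior a b x)
           \<le> (y - x) * (a * (1 - y) + b * y)"
proof -
  have "posterior a b x \<le> posterior a b y \<and>
    (a * x + b * (1 - x)) * (posterior a b y - posterior a b x) \<le> (y - x) * (a * (1 - y) + b * y)"
  proof (cases "a = 0 \<or> b = 0")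
    case True
    then show ?thesis using ab xy by (auto simp: posterior_def)
  next
    case False
    then have pos: "0 < a" "0 < b" using ab by auto
    define r s where "r = a * x + b * (1 - x)" and "s = a * y + b * (1 - y)"
    have rs: "0 < r" "0 < s" using pos xy by (auto simp: r_def s_def intro!: obs_pos)
    have eq: "posterior a b y - posterior a b x = (y - x) * (a * b) / (r * s)"
    proof -
      have "a * y * r - a * x * s = (y - x) * (a * b)"
        by (simp add: r_def s_def algebra_simps)
      moreover have "posterior a b y - posterior a b x = a * y / s - a * x / r"
        using pos by (simp add: posterior_def r_def s_def)
      ultimately show ?thesis
        using rs by (simp add: diff_frac_eq mult.commute)
    qed
    \<comment> \<open>the inequality between the harmonic and the arithmetic mean, with its explicit defect\<close>
    have "s * (a * (1 - y) + b * y) - a * b = (a - b)\<^sup>2 * (y * (1 - y))"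
      by (simp add: s_def power2_eq_square algebra_simps)
    moreover have "0 \<le> (a - b)\<^sup>2 * (y * (1 - y))" using xy by simp
    ultimately have "a * b / s \<le> a * (1 - y) + b * y"
      using rs by (simp add: pos_divide_le_eq mult.commute)
    then have "(y - x) * (a * b / s) \<le> (y - x) * (a * (1 - y) + b * y)"
      using xy by (intro mult_left_mono) auto
    moreover have "r * (posterior a b y - posterior a b x) = (y - x) * (a * b / s)"
      using rs by (simp add: eq)
    moreover have "0 \<le> (y - x) * (a * b) / (r * s)" using rs pos xy by simp
    ultimately show ?thesis using eq unfolding r_def by linarith
  qed
  then show "posterior a b x \<le> posterior a b y"
    "(a * x + b * (1 - x)) * (posterior a b y - posterior a b x) \<le> (y - x) * (a * (1 - y) + b * y)"
    by auto
qed

lemma posterior_ge_prior: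
  assumes "0 \<le> b" "b < a" "y \<in> {0..1}"
  shows "y \<le> posterior a b y"
proof (cases "b = 0")
  case False
  then have r: "0 < a * y + b * (1 - y)" using assms by (intro obs_pos) auto
  have "a * y - y * (a * y + b * (1 - y)) = (a - b) * (y * (1 - y))"
    by (simp add: algebra_simps)
  moreover have "0 \<le> (a - b) * (y * (1 - y))" using assms by simp
  ultimately have "y * (a * y + b * (1 - y)) \<le> a * y" by linarith
  then show ?thesis using r False assms
    by (simp add: posterior_def pos_le_divide_eq)
qed (use assms in \<open>auto simp: posterior_def\<close>)

lemma posterior_le_prior:
  assumes "0 \<le> a" "a < b" "y \<in> {0..1}"
  shows "posterior a b y \<le> y"
proof (cases "a = 0")
  case False
  then have r: "0 < a * y + b * (1 - y)" using assms by (intro obs_pos) auto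
  have "y * (a * y + b * (1 - y)) - a * y = (b - a) * (y * (1 - y))"
    by (simp add: algebra_simps)
  moreover have "0 \<le> (b - a) * (y * (1 - y))" using assms by simp
  ultimately have "a * y \<le> y * (a * y + b * (1 - y))" by linarith
  then show ?thesis using r False assms
    by (simp add: posterior_def pos_divide_le_eq)
qed (use assms in \<open>auto simp: posterior_def\<close>)

text \<open>
  An observation that is likelier in state 1 raises the belief from \<open>y\<close> to at most \<open>1\<close>, and an
  observation that is likelier in state 0 lowers it to at least \<open>0\<close>.  Hence \<open>a - b\<close> and the
  displacement of the belief never have opposite signs, and the bounds on the slope keep their
  roles in both cases.
\<close>

lemma posterior_value_deviation:
  assumes f: "slopes_in l u f" and lu: "l \<le> 0" "0 \<le> u"
    and ab: "0 \<le> a" "0 \<le> b" and y: "y \<in> {0..1}"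
  defines "e \<equiv> max 0 (a - b) * (1 - y) + max 0 (b - a) * y"
  shows "l * e \<le> (a - b) * (f (posterior a b y) - f y)"
    and "(a - b) * (f (posterior a b y) - f y) \<le> u * e"
proof -
  let ?p = "posterior a b y"
  have p: "?p \<in> {0..1}" by (rule posterior_in[OF ab y])
  consider "a = b" | "b < a" | "a < b" by linarith
  then have "l * e \<le> (a - b) * (f ?p - f y) \<and> (a - b) * (f ?p - f y) \<le> u * e"
  proof cases
    case 1
    then show ?thesis by (simp add: e_def)
  next
    case 2
    have le: "y \<le> ?p" using 2 ab y by (intro posterior_ge_prior) auto
    have "l * (1 - y) \<le> l * (?p - y)" "u * (?p - y) \<le> u * (1 - y)"
      using lu p by (auto intro: mult_left_mono mult_left_mono_neg)
    then have "l * (1 - y) \<le> f ?p - f y" "f ?p - f y \<le> u * (1 - y)"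
      using slopes_inD[OF f _ le] p y by force+
    then have "(a - b) * (l * (1 - y)) \<le> (a - b) * (f ?p - f y)"
      "(a - b) * (f ?p - f y) \<le> (a - b) * (u * (1 - y))"
      using 2 by (auto intro: mult_left_mono)
    then show ?thesis using 2 by (simp add: e_def mult_ac)
  next
    case 3
    have le: "?p \<le> y" using 3 ab y by (intro posterior_le_prior) auto
    have "l * y \<le> l * (y - ?p)" "u * (y - ?p) \<le> u * y"
      using lu p by (auto intro: mult_left_mono mult_left_mono_neg)
    then have "l * y \<le> f y - f ?p" "f y - f ?p \<le> u * y"
      using slopes_inD[OF f _ le] p y by force+
    then have "(b - a) * (l * y) \<le> (b - a) * (f y - f ?p)"
      "(b - a) * (f y - f ?p) \<le> (b - a) * (u * y)"
      using 3 by (auto intro: mult_left_mono)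
    moreover have "(b - a) * (f y - f ?p) = (a - b) * (f ?p - f y)" by (simp add: algebra_simps)
    ultimately show ?thesis using 3 by (simp add: e_def mult_ac)
  qed
  then show "l * e \<le> (a - b) * (f ?p - f y)" "(a - b) * (f ?p - f y) \<le> u * e" by auto
qed

text \<open>
  The contribution of one observation to the increment of the expectation of \<open>f\<close> at the posterior.
  The term with \<open>(a - b) * f y\<close> is subtracted because it cancels in the sum over all observations.
\<close>

lemma weighted_posterior_value_increment:
  assumes f: "slopes_in l u f" and lu: "l \<le> 0" "0 \<le> u"
    and ab: "0 \<le> a" "0 \<le> b" and xy: "0 \<le> x" "x \<le> y" "y \<le> 1"
  defines "e \<equiv> a * (1 - y) + b * y + max 0 (a - b) * (1 - y) + max 0 (b - a) * y"
    and "G \<equiv> \<lambda>w. (a * w + b * (1 - w)) * f (posterior a b w)"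
  shows "(y - x) * (l * e) \<le> G y - G x - (y - x) * ((a - b) * f y)"
    and "G y - G x - (y - x) * ((a - b) * f y) \<le> (y - x) * (u * e)"
proof -
  define r where "r = a * x + b * (1 - x)"
  define d where "d = a * (1 - y) + b * y"
  define e' where "e' = max 0 (a - b) * (1 - y) + max 0 (b - a) * y"
  let ?p = "posterior a b"
  have r0: "0 \<le> r" using ab xy by (simp add: r_def)
  have px: "?p x \<in> {0..1}" and py: "?p y \<in> {0..1}"
    using xy by (intro posterior_in[OF ab]; simp)+
  note inc = posterior_increment[OF ab xy, folded r_def d_def]
  have "l * (?p y - ?p x) \<le> f (?p y) - f (?p x)" "f (?p y) - f (?p x) \<le> u * (?p y - ?p x)"
    using slopes_inD[OF f _ inc(1)] px py by auto
  then have 1: "l * (r * (?p y - ?p x)) \<le> r * (f (?p y) - f (?p x))"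
      "r * (f (?p y) - f (?p x)) \<le> u * (r * (?p y - ?p x))"
    using r0 by (metis mult.left_commute mult_left_mono)+
  have 2: "l * ((y - x) * d) \<le> l * (r * (?p y - ?p x))" "u * (r * (?p y - ?p x)) \<le> u * ((y - x) * d)"
    using lu inc(2) by (auto intro: mult_left_mono mult_left_mono_neg)
  have y: "y \<in> {0..1}" using xy by simp
  note dev = posterior_value_deviation[OF f lu ab y, folded e'_def]
  have 3: "(y - x) * (l * e') \<le> (y - x) * ((a - b) * (f (?p y) - f y))"
     "(y - x) * ((a - b) * (f (?p y) - f y)) \<le> (y - x) * (u * e')"
    using dev xy by (auto intro: mult_left_mono)
  \<comment> \<open>discrete product rule: the posterior moves under the old law, then the law moves\<close>
  have eq: "G y - G x - (y - x) * ((a - b) * f y) =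
      r * (f (?p y) - f (?p x)) + (y - x) * ((a - b) * (f (?p y) - f y))"
    by (simp add: G_def r_def algebra_simps)
  have e: "e = d + e'" by (simp add: e_def d_def e'_def)
  show "(y - x) * (l * e) \<le> G y - G x - (y - x) * ((a - b) * f y)"
    using 1 2 3 unfolding eq e by (simp add: algebra_simps)
  show "G y - G x - (y - x) * ((a - b) * f y) \<le> (y - x) * (u * e)"
    using 1 2 3 unfolding eq e by (simp add: algebra_simps)
qed

lemma sum_max_eq_pos_part_sum:
  "(\<Sum>i=1..K. max 0 (q1 i - q0 i)) = pos_part_sum K q1 q0"
proof -
  have "(\<Sum>i=1..K. max 0 (q1 i - q0 i)) = (\<Sum>i=1..K. if q1 i - q0 i \<ge> 0 then q1 i - q0 i else 0)"
    by (intro sum.cong) auto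
  also have "\<dots> = pos_part_sum K q1 q0"
    unfolding pos_part_sum_def by (subst sum.inter_filter) auto
  finally show ?thesis .
qed

lemma pos_part_sum_nonneg: "0 \<le> pos_part_sum K q1 q0"
  unfolding pos_part_sum_def by (intro sum_nonneg) auto

lemma pos_part_sum_commute:
  assumes "prob_vector K q1" "prob_vector K q0"
  shows "pos_part_sum K q0 q1 = pos_part_sum K q1 q0"
proof -
  have "(\<Sum>i=1..K. max 0 (q0 i - q1 i)) = (\<Sum>i=1..K. max 0 (q1 i - q0 i) - q1 i + q0 i)"
    by (intro sum.cong) auto
  then show ?thesis
    using assms by (simp add: sum.distrib sum_subtractf prob_vector_def sum_max_eq_pos_part_sum
        del: One_nat_def)
qed

definition posterior_average ::
  "nat \<Rightarrow> (nat \<Rightarrow> real) \<Rightarrow> (nat \<Rightarrow> real) \<Rightarrow> (real \<Rightarrow> real) \<Rightarrow> real \<Rightarrow> real" where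
  "posterior_average K q1 q0 f w = (\<Sum>i=1..K. obs_prob q1 q0 w i * f (posterior (q1 i) (q0 i) w))"

text \<open>
  In the sum of the bounds on the single observations, the terms for the motion of the posteriors
  add up to \<open>1\<close>.  Those for the change of the law add up to \<open>\<Delta> (1 - y) + \<Delta> y = \<Delta>\<close>, since the
  positive and the negative part of \<open>q1 - q0\<close> have the same mass.
\<close>

lemma slopes_in_posterior_average:
  assumes q: "prob_vector K q1" "prob_vector K q0"
    and f: "slopes_in l u f" and lu: "l \<le> 0" "0 \<le> u"
  defines "\<Delta> \<equiv> pos_part_sum K q1 q0"
  shows "slopes_in (l * (1 + \<Delta>)) (u * (1 + \<Delta>)) (posterior_average K q1 q0 f)"
  unfolding slopes_in_def
proof (intro allI impI)
  fix x y :: real assume xy: "0 \<le> x" "x \<le> y" "y \<le> 1"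
  define e where "e = (\<lambda>i. q1 i * (1 - y) + q0 i * y
     + max 0 (q1 i - q0 i) * (1 - y) + max 0 (q0 i - q1 i) * y)"
  define G where "G = (\<lambda>i w. obs_prob q1 q0 w i * f (posterior (q1 i) (q0 i) w))"
  have nonneg: "0 \<le> q1 i" "0 \<le> q0 i" if "i \<in> {1..K}" for i
    using q that by (auto simp: prob_vector_def)
  have sums: "(\<Sum>i=1..K. q1 i) = 1" "(\<Sum>i=1..K. q0 i) = 1"
    using q by (auto simp: prob_vector_def)
  have e: "(\<Sum>i=1..K. e i) = 1 + \<Delta>"
  proof -
    have "(\<Sum>i=1..K. e i) = 1 * (1 - y) + 1 * y + \<Delta> * (1 - y) + \<Delta> * y"
      unfolding e_def \<Delta>_def
      by (simp only: sum.distrib sum_distrib_right[symmetric] sums sum_max_eq_pos_part_sum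
          pos_part_sum_commute[OF q])
    then show ?thesis by (simp add: algebra_simps)
  qed
  have inc: "(y - x) * (l * e i) \<le> G i y - G i x - (y - x) * ((q1 i - q0 i) * f y)"
    "G i y - G i x - (y - x) * ((q1 i - q0 i) * f y) \<le> (y - x) * (u * e i)" if "i \<in> {1..K}" for i
    using weighted_posterior_value_increment[OF f lu nonneg[OF that] xy]
    by (auto simp: G_def e_def obs_prob_def)
  have zero: "(\<Sum>i=1..K. (y - x) * ((q1 i - q0 i) * f y)) = 0"
    by (simp add: sum_distrib_left[symmetric] sum_distrib_right[symmetric] sum_subtractf sums
        del: One_nat_def)
  have G: "(\<Sum>i=1..K. G i y - G i x - (y - x) * ((q1 i - q0 i) * f y)) =
      posterior_average K q1 q0 f y - posterior_average K q1 q0 f x"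
    by (simp only: sum_subtractf zero) (simp add: G_def posterior_average_def)
  have total: "(\<Sum>i=1..K. (y - x) * (k * e i)) = k * (1 + \<Delta>) * (y - x)" for k
    by (simp only: sum_distrib_left[symmetric] e) (simp add: mult_ac)
  have "(\<Sum>i=1..K. (y - x) * (l * e i)) \<le>
      (\<Sum>i=1..K. G i y - G i x - (y - x) * ((q1 i - q0 i) * f y))"
    "(\<Sum>i=1..K. G i y - G i x - (y - x) * ((q1 i - q0 i) * f y)) \<le>
      (\<Sum>i=1..K. (y - x) * (u * e i))"
    by (intro sum_mono inc; assumption)+
  then show "l * (1 + \<Delta>) * (y - x) \<le> posterior_average K q1 q0 f y - posterior_average K q1 q0 f x \<and>
      posterior_average K q1 q0 f y - posterior_average K q1 q0 f x \<le> u * (1 + \<Delta>) * (y - x)"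
    unfolding G total by simp
qed

lemma one_sided_differentiable_posterior_average:
  assumes q: "prob_vector K q1" "prob_vector K q0" and f: "one_sided_differentiable f"
  shows "one_sided_differentiable (posterior_average K q1 q0 f)"
proof -
  have "one_sided_differentiable (\<lambda>w. f (posterior a b w))" if ab: "0 \<le> a" "0 \<le> b" for a b
  proof (cases "a = 0 \<or> b = 0")
    case True
    then have "posterior a b = (\<lambda>w. 0) \<or> posterior a b = (\<lambda>w. 1)"
      by (auto simp: posterior_def fun_eq_iff)
    then show ?thesis by (auto simp: one_sided_differentiable_const)
  next
    case False
    then have pos: "0 < a" "0 < b" using ab by auto
    show ?thesis
    proof (rule one_sided_differentiable_compose_mono[OF f])
      show "posterior a b x \<in> {0<..<1}" if "x \<in> {0<..<1}" for x
        using posterior_in_open pos that by blast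
      show "mono_on {0<..<1} (posterior a b)"
        by (auto simp: mono_on_def intro!: posterior_increment(1)[OF ab])
      show "posterior a b differentiable at x" if "x \<in> {0<..<1}" for x
      proof -
        have "posterior a b = (\<lambda>w. a * w / (a * w + b * (1 - w)))"
          using pos by (auto simp: posterior_def)
        moreover have "a * x + b * (1 - x) \<noteq> 0"
          using obs_pos[OF pos, of x] that by auto
        ultimately show ?thesis by simp
      qed
    qed
  qed
  moreover have "one_sided_differentiable (\<lambda>w. obs_prob q1 q0 w i)" for i
    unfolding obs_prob_def by (intro one_sided_differentiableI) simp
  ultimately show ?thesis using q unfolding posterior_average_def[abs_def]
    by (intro one_sided_differentiable_sum one_sided_differentiable_mult)
      (auto simp: prob_vector_def)
qed

section \<open>The Bellman recursion\<close>

lemma belief_step_in: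
  assumes "p01 \<in> {0..1}" "p11 \<in> {0..1}" "w \<in> {0..1}"
  shows "belief_step p01 p11 w \<in> {0..1}"
proof -
  have "belief_step p01 p11 w \<le> 1 * w + 1 * (1 - w)"
    unfolding belief_step_def using assms by (intro add_mono mult_right_mono) auto
  then show ?thesis using assms by (auto simp: belief_step_def)
qed

lemma belief_step_in_open:
  assumes "p01 \<in> {0..1}" "p11 \<in> {0..1}" "p11 \<noteq> p01" "w \<in> {0<..<1}"
  shows "belief_step p01 p11 w \<in> {0<..<1}"
proof -
  have lower: "0 < p * w + q * (1 - w)" if "0 \<le> p" "0 \<le> q" "p \<noteq> q" for p q
    using that assms(4) by (cases "p = 0") (auto intro: add_pos_nonneg)
  have "1 - belief_step p01 p11 w = (1 - p11) * w + (1 - p01) * (1 - w)"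
    by (simp add: belief_step_def algebra_simps)
  with lower[of "1 - p11" "1 - p01"] lower[of p11 p01] assms show ?thesis
    by (auto simp: belief_step_def)
qed

lemma belief_step_diff: "belief_step p01 p11 y - belief_step p01 p11 x = (p11 - p01) * (y - x)"
  by (simp add: belief_step_def algebra_simps)

text \<open>
  Updating on an observation and letting the chain move once are separate steps of
  \<open>belief_update\<close>, which is Bayes' rule followed by \<open>belief_step\<close>.
\<close>

lemma active_step_eq_posterior_average:
  assumes q: "prob_vector K q1" "prob_vector K q0" and w: "w \<in> {0..1}"
  shows "active_step p01 p11 K q1 q0 \<beta> W w =
    w + \<beta> * posterior_average K q1 q0 (\<lambda>z. W (belief_step p01 p11 z)) w"
proof -
  have "obs_prob q1 q0 w i * W (belief_update p01 p11 q1 q0 w i) =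
      obs_prob q1 q0 w i * W (belief_step p01 p11 (posterior (q1 i) (q0 i) w))"
    if i: "i \<in> {1..K}" for i
  proof (cases "obs_prob q1 q0 w i = 0")
    case False
    have "belief_update p01 p11 q1 q0 w i = belief_step p01 p11 (posterior (q1 i) (q0 i) w)"
    proof (cases "q1 i = 0 \<or> q0 i = 0")
      case True
      with False show ?thesis
        by (auto simp: belief_update_def belief_step_def posterior_def obs_prob_def)
    next
      case nz: False
      let ?r = "q1 i * w + q0 i * (1 - w)"
      have r: "?r \<noteq> 0" using False by (simp add: obs_prob_def)
      have "1 - q1 i * w / ?r = q0 i * (1 - w) / ?r"
        using r by (simp add: field_simps)
      then show ?thesis using nz
        by (simp add: belief_update_def belief_step_def posterior_def obs_prob_def add_divide_distrib mult.assoc)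
    qed
    then show ?thesis by simp
  qed simp
  then have "(\<Sum>i=1..K. obs_prob q1 q0 w i * W (belief_update p01 p11 q1 q0 w i)) =
      posterior_average K q1 q0 (\<lambda>z. W (belief_step p01 p11 z)) w"
    unfolding posterior_average_def by (intro sum.cong) auto
  then show ?thesis
    by (simp add: active_step_def)
qed

lemma one_sided_differentiable_belief_step:
  assumes p: "p01 \<in> {0..1}" "p11 \<in> {0..1}" "p11 \<noteq> p01" and W: "one_sided_differentiable W"
  shows "one_sided_differentiable (\<lambda>w. W (belief_step p01 p11 w))"
proof (cases "p01 < p11")
  case True
  show ?thesis
  proof (rule one_sided_differentiable_compose_mono[OF W])
    show "mono_on {0<..<1} (belief_step p01 p11)"
    proof (rule mono_onI)
      fix x y :: real assume "x \<le> y"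
      with True have "0 \<le> (p11 - p01) * (y - x)" by simp
      with belief_step_diff[of p01 p11 y x] show "belief_step p01 p11 x \<le> belief_step p01 p11 y"
        by linarith
    qed
    show "belief_step p01 p11 differentiable at x" for x
      unfolding belief_step_def[abs_def] by simp
  qed (use belief_step_in_open[OF p] in blast)
next
  case False
  have "one_sided_differentiable (\<lambda>w. W (1 - (1 - belief_step p01 p11 w)))"
  proof (rule one_sided_differentiable_compose_mono[OF one_sided_differentiable_reflect[OF W]])
    show "mono_on {0<..<1} (\<lambda>w. 1 - belief_step p01 p11 w)"
    proof (rule mono_onI)
      fix x y :: real assume "x \<le> y"
      with False have "(p11 - p01) * (y - x) \<le> 0" by (simp add: mult_nonpos_nonneg)
      with belief_step_diff[of p01 p11 y x]
      show "1 - belief_step p01 p11 x \<le> 1 - belief_step p01 p11 y"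
        by linarith
    qed
    show "(\<lambda>w. 1 - belief_step p01 p11 w) differentiable at x" for x
      unfolding belief_step_def[abs_def] by simp
    show "1 - belief_step p01 p11 x \<in> {0<..<1}" if "x \<in> {0<..<1}" for x
      using belief_step_in_open[OF p that] by simp
  qed
  then show ?thesis by simp
qed

text \<open>
  The minimum and the maximum account for the sign of \<open>p11 - p01\<close>.
\<close>

lemma slopes_in_belief_step:
  assumes p: "p01 \<in> {0..1}" "p11 \<in> {0..1}" and W: "slopes_in L U W"
  shows "slopes_in (min ((p11 - p01) * L) ((p11 - p01) * U))
           (max ((p11 - p01) * L) ((p11 - p01) * U)) (\<lambda>w. W (belief_step p01 p11 w))"
proof (cases "p01 \<le> p11")
  case True
  have "slopes_in ((p11 - p01) * L) ((p11 - p01) * U) (\<lambda>w. W (belief_step p01 p11 w))"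
    unfolding slopes_in_def
  proof (intro allI impI)
    fix x y :: real assume xy: "0 \<le> x" "x \<le> y" "y \<le> 1"
    have diff: "belief_step p01 p11 y - belief_step p01 p11 x = (p11 - p01) * (y - x)"
      by (rule belief_step_diff)
    moreover have "0 \<le> (p11 - p01) * (y - x)" using True xy by simp
    ultimately have "belief_step p01 p11 x \<le> belief_step p01 p11 y" by linarith
    from slopes_inD[OF W _ this] show "(p11 - p01) * L * (y - x) \<le>
        W (belief_step p01 p11 y) - W (belief_step p01 p11 x) \<and>
        W (belief_step p01 p11 y) - W (belief_step p01 p11 x) \<le> (p11 - p01) * U * (y - x)"
      using belief_step_in[OF p, of x] belief_step_in[OF p, of y] xy
      by (simp add: diff mult_ac)
  qed
  then show ?thesis by (rule slopes_in_mono) auto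
next
  case False
  have "slopes_in ((p11 - p01) * U) ((p11 - p01) * L) (\<lambda>w. W (belief_step p01 p11 w))"
    unfolding slopes_in_def
  proof (intro allI impI)
    fix x y :: real assume xy: "0 \<le> x" "x \<le> y" "y \<le> 1"
    have diff: "belief_step p01 p11 x - belief_step p01 p11 y = - ((p11 - p01) * (y - x))"
      using belief_step_diff[of p01 p11 y x] by simp
    moreover have "(p11 - p01) * (y - x) \<le> 0" using False xy by (simp add: mult_nonpos_nonneg)
    ultimately have "belief_step p01 p11 y \<le> belief_step p01 p11 x" by linarith
    from slopes_inD[OF W _ this] show "(p11 - p01) * U * (y - x) \<le>
        W (belief_step p01 p11 y) - W (belief_step p01 p11 x) \<and>
        W (belief_step p01 p11 y) - W (belief_step p01 p11 x) \<le> (p11 - p01) * L * (y - x)"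
      using belief_step_in[OF p, of x] belief_step_in[OF p, of y] xy
      by (simp add: diff mult_ac)
  qed
  then show ?thesis by (rule slopes_in_mono) auto
qed

lemma one_sided_differentiable_passive_step:
  assumes "p01 \<in> {0..1}" "p11 \<in> {0..1}" "p11 \<noteq> p01" "one_sided_differentiable W"
  shows "one_sided_differentiable (passive_step p01 p11 m \<beta> W)"
  unfolding passive_step_def[abs_def]
  by (intro one_sided_differentiable_add one_sided_differentiable_mult
      one_sided_differentiable_const one_sided_differentiable_belief_step assms)

lemma one_sided_differentiable_active_step:
  assumes p: "p01 \<in> {0..1}" "p11 \<in> {0..1}" "p11 \<noteq> p01"
    and q: "prob_vector K q1" "prob_vector K q0" and W: "one_sided_differentiable W"
  shows "one_sided_differentiable (active_step p01 p11 K q1 q0 \<beta> W)"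
proof -
  have "one_sided_differentiable
      (\<lambda>w. w + \<beta> * posterior_average K q1 q0 (\<lambda>z. W (belief_step p01 p11 z)) w)"
    by (intro one_sided_differentiable_add one_sided_differentiable_mult
        one_sided_differentiable_const one_sided_differentiable_posterior_average q
        one_sided_differentiable_belief_step p W) (intro one_sided_differentiableI, simp)
  then show ?thesis
    by (rule one_sided_differentiable_cong) (simp add: active_step_eq_posterior_average[OF q])
qed

lemma one_sided_differentiable_V:
  assumes "p01 \<in> {0..1}" "p11 \<in> {0..1}" "p11 \<noteq> p01" "prob_vector K q1" "prob_vector K q0"
  shows "one_sided_differentiable (V p01 p11 K q1 q0 m \<beta> T)"
proof (induction T)
  case 0
  show ?case by (simp add: one_sided_differentiable_const)
next
  case (Suc T)
  show ?case
    unfolding V.simps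
    by (intro one_sided_differentiable_max one_sided_differentiable_passive_step
        one_sided_differentiable_active_step assms Suc)
qed

lemma slopes_in_steps:
  assumes p: "p01 \<in> {0..1}" "p11 \<in> {0..1}"
    and q: "prob_vector K q1" "prob_vector K q0" and \<beta>: "0 \<le> \<beta>"
    and W: "slopes_in L U W" and LU: "L \<le> 0" "0 \<le> U"
  defines "l \<equiv> \<beta> * min ((p11 - p01) * L) ((p11 - p01) * U)"
    and "u \<equiv> \<beta> * max ((p11 - p01) * L) ((p11 - p01) * U)"
    and "\<Delta> \<equiv> pos_part_sum K q1 q0"
  shows "slopes_in l u (passive_step p01 p11 m \<beta> W)"
    and "slopes_in (1 + l * (1 + \<Delta>)) (1 + u * (1 + \<Delta>)) (active_step p01 p11 K q1 q0 \<beta> W)"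
proof -
  note f = slopes_in_belief_step[OF p W]
  show "slopes_in l u (passive_step p01 p11 m \<beta> W)"
    using slopes_in_affine[OF f \<beta>, of 0 m] by (simp add: l_def u_def passive_step_def[abs_def])
  have "min ((p11 - p01) * L) ((p11 - p01) * U) \<le> 0" "0 \<le> max ((p11 - p01) * L) ((p11 - p01) * U)"
    using LU by (auto simp: min_le_iff_disj le_max_iff_disj mult_le_0_iff zero_le_mult_iff)
  from slopes_in_affine[OF slopes_in_posterior_average[OF q f this] \<beta>, of 1 0]
  have "slopes_in (1 + l * (1 + \<Delta>)) (1 + u * (1 + \<Delta>))
      (\<lambda>w. w + \<beta> * posterior_average K q1 q0 (\<lambda>z. W (belief_step p01 p11 z)) w)"
    by (simp add: l_def u_def \<Delta>_def mult.assoc)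
  then show "slopes_in (1 + l * (1 + \<Delta>)) (1 + u * (1 + \<Delta>)) (active_step p01 p11 K q1 q0 \<beta> W)"
    by (rule slopes_in_cong) (simp add: active_step_eq_posterior_average[OF q])
qed

lemma slopes_in_V:
  assumes LU: "L \<le> 0" "0 \<le> U"
    and step: "\<And>W. slopes_in L U W \<Longrightarrow> slopes_in L U (passive_step p01 p11 m \<beta> W) \<and>
       slopes_in L U (active_step p01 p11 K q1 q0 \<beta> W)"
  shows "slopes_in L U (V p01 p11 K q1 q0 m \<beta> T)"
proof (induction T)
  case 0
  show ?case using LU by (auto simp: slopes_in_def mult_le_0_iff)
next
  case (Suc T)
  then show ?case using step by (simp add: slopes_in_max)
qed

text \<open>
  The bound on \<open>\<beta>\<close> enters only here.  With \<open>c = \<beta> \<bar>p11 - p01\<bar>\<close> it says \<open>2 c (1 + \<Delta>) \<le> 1\<close> for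
  \<open>p11 > p01\<close>, and \<open>c (3 + 4 \<Delta>) \<le> 1\<close> otherwise.  In the first case, slopes of \<open>W\<close> in \<open>[0, 2]\<close>
  give passive slopes in \<open>[0, 2 c]\<close> and active slopes in \<open>[1, 1 + 2 c (1 + \<Delta>)]\<close>.  In the second
  case the orientation is reversed, so a decreasing continuation value has to be admitted: slopes
  in \<open>[-1/2, 3/2]\<close> give passive slopes in \<open>[-3/2 c, c/2]\<close> and active slopes in
  \<open>[1 - 3/2 c (1 + \<Delta>), 1 + c/2 (1 + \<Delta>)]\<close>, where \<open>c (1 + \<Delta>) \<le> 1/3\<close>.
\<close>

lemma slope_separation:
  assumes p: "p01 \<in> {0..1}" "p11 \<in> {0..1}"
    and q: "prob_vector K q1" "prob_vector K q0"
    and ne: "p11 \<noteq> p01" and \<beta>0: "0 < \<beta>"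
    and \<beta>: "\<beta> \<le> (if p11 > p01
                then 1 / (2 * (p11 - p01) * (1 + pos_part_sum K q1 q0))
                else 1 / ((p01 - p11) * (3 + 4 * pos_part_sum K q1 q0)))"
  obtains L U s where "L \<le> 0" "0 \<le> U" "L \<le> s" "s \<le> U"
    "\<And>W. slopes_in L U W \<Longrightarrow> slopes_in L s (passive_step p01 p11 m \<beta> W)"
    "\<And>W. slopes_in L U W \<Longrightarrow> slopes_in s U (active_step p01 p11 K q1 q0 \<beta> W)"
proof -
  define \<Delta> where "\<Delta> = pos_part_sum K q1 q0"
  have \<Delta>: "0 \<le> \<Delta>" by (simp add: \<Delta>_def pos_part_sum_nonneg)
  define c where "c = \<beta> * \<bar>p11 - p01\<bar>"
  have c: "0 < c" using \<beta>0 ne by (simp add: c_def)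
  then have c\<Delta>: "0 \<le> c * \<Delta>" using \<Delta> by simp
  note steps = slopes_in_steps[OF p q less_imp_le[OF \<beta>0], folded \<Delta>_def]
  show thesis
  proof (cases "p11 > p01")
    case True
    have "0 < 2 * (p11 - p01) * (1 + \<Delta>)" using True \<Delta> by simp
    with \<beta> True have "\<beta> * (2 * (p11 - p01) * (1 + \<Delta>)) \<le> 1"
      by (simp add: \<Delta>_def pos_le_divide_eq)
    then have b: "2 * c + 2 * (c * \<Delta>) \<le> 1" using True by (simp add: c_def algebra_simps)
    have lu: "\<beta> * min ((p11 - p01) * 0) ((p11 - p01) * 2) = 0"
      "\<beta> * max ((p11 - p01) * 0) ((p11 - p01) * 2) = 2 * c"
      using True by (auto simp: c_def min_def max_def)
    have bounds: "2 * c \<le> 1" "1 + 2 * c * (1 + \<Delta>) \<le> 2"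
      using b c\<Delta> by (auto simp: algebra_simps)
    show thesis
    proof (rule that[of 0 2 1])
      fix W assume "slopes_in 0 2 W"
      note st = steps[OF this, unfolded lu]
      show "slopes_in 0 1 (passive_step p01 p11 m \<beta> W)"
        using bounds by (intro slopes_in_mono[OF st(1)]) auto
      show "slopes_in 1 2 (active_step p01 p11 K q1 q0 \<beta> W)"
        using bounds by (intro slopes_in_mono[OF st(2)]) auto
    qed auto
  next
    case False
    then have lt: "p11 < p01" using ne by simp
    have "0 < (p01 - p11) * (3 + 4 * \<Delta>)" using lt \<Delta> by simp
    with \<beta> False have "\<beta> * ((p01 - p11) * (3 + 4 * \<Delta>)) \<le> 1"
      by (simp add: \<Delta>_def pos_le_divide_eq)
    then have b: "3 * c + 4 * (c * \<Delta>) \<le> 1" using lt by (simp add: c_def algebra_simps)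
    have "(p11 - p01) * (3 / 2) \<le> (p11 - p01) * (- 1 / 2)"
      using lt by (intro mult_left_mono_neg) auto
    then have lu: "\<beta> * min ((p11 - p01) * (- 1 / 2)) ((p11 - p01) * (3 / 2)) = - (3 / 2) * c"
      "\<beta> * max ((p11 - p01) * (- 1 / 2)) ((p11 - p01) * (3 / 2)) = c / 2"
      using lt by (auto simp: c_def min_def max_def field_simps)
    have bounds: "- 1 / 2 \<le> - (3 / 2) * c" "c / 2 \<le> 1 / 2"
      "1 / 2 \<le> 1 + - (3 / 2) * c * (1 + \<Delta>)" "1 + c / 2 * (1 + \<Delta>) \<le> 3 / 2"
    proof -
      have "k * c * (1 + \<Delta>) = k * c + k * (c * \<Delta>)" for k
        by (simp add: algebra_simps)
      from this[of "- (3 / 2)"] this[of "1 / 2"]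
      show "- 1 / 2 \<le> - (3 / 2) * c" "c / 2 \<le> 1 / 2"
        "1 / 2 \<le> 1 + - (3 / 2) * c * (1 + \<Delta>)" "1 + c / 2 * (1 + \<Delta>) \<le> 3 / 2"
        using b c c\<Delta> by linarith+
    qed
    show thesis
    proof (rule that[of "- 1 / 2" "3 / 2" "1 / 2"])
      fix W assume "slopes_in (- 1 / 2) (3 / 2) W"
      note st = steps[OF this, unfolded lu]
      show "slopes_in (- 1 / 2) (1 / 2) (passive_step p01 p11 m \<beta> W)"
        using bounds by (intro slopes_in_mono[OF st(1)]) auto
      show "slopes_in (1 / 2) (3 / 2) (active_step p01 p11 K q1 q0 \<beta> W)"
        using bounds by (intro slopes_in_mono[OF st(2)]) auto
    qed auto
  qed
qed

theorem lemma4: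
  fixes p01 p11 m \<beta> \<omega> :: real and K T :: nat and q1 q0 :: "nat \<Rightarrow> real"
  assumes "p01 \<in> {0..1}" and "p11 \<in> {0..1}"
    and "K \<ge> 1" and "prob_vector K q1" and "prob_vector K q0"
    and "p11 \<noteq> p01"
    and "0 < \<beta>" and "\<beta> < 1"
    and "\<beta> \<le> (if p11 > p01
                then 1 / (2 * (p11 - p01) * (1 + pos_part_sum K q1 q0))
                else 1 / ((p01 - p11) * (3 + 4 * pos_part_sum K q1 q0)))"
    and "T \<ge> 1" and "\<omega> \<in> {0<..<1}"
  shows "\<exists>D1 D0.
           (V_active p01 p11 K q1 q0 m \<beta> T has_real_derivative D1) (at_right \<omega>) \<and>
           (V_passive p01 p11 K q1 q0 m \<beta> T has_real_derivative D0) (at_right \<omega>) \<and>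
           D1 \<ge> D0"
proof -
  note p = assms(1,2) and q = assms(4,5) and ne = assms(6) and \<omega> = assms(11)
  obtain L U s where LU: "L \<le> 0" "0 \<le> U" "L \<le> s" "s \<le> U"
    and slope_passive: "\<And>W. slopes_in L U W \<Longrightarrow> slopes_in L s (passive_step p01 p11 m \<beta> W)"
    and slope_active: "\<And>W. slopes_in L U W \<Longrightarrow> slopes_in s U (active_step p01 p11 K q1 q0 \<beta> W)"
    using slope_separation[OF p q ne assms(7,9)] by metis
  have slopes: "slopes_in L U (V p01 p11 K q1 q0 m \<beta> n)" for n
    using LU slope_passive slope_active by (intro slopes_in_V) (auto intro: slopes_in_mono)
  note diff = one_sided_differentiable_V[OF p ne q]
  obtain D1 where D1: "(V_active p01 p11 K q1 q0 m \<beta> T has_real_derivative D1) (at_right \<omega>)"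
    unfolding V_active_def
    using one_sided_differentiable_right_derivative
      [OF one_sided_differentiable_active_step[OF p ne q diff] \<omega>] by metis
  obtain D0 where D0: "(V_passive p01 p11 K q1 q0 m \<beta> T has_real_derivative D0) (at_right \<omega>)"
    unfolding V_passive_def
    using one_sided_differentiable_right_derivative
      [OF one_sided_differentiable_passive_step[OF p ne diff] \<omega>] by metis
  have "s \<le> D1"
    using right_derivative_bounds_of_slopes_in(1)[OF slope_active[OF slopes] \<omega>] D1
    by (simp add: V_active_def)
  moreover have "D0 \<le> s"
    using right_derivative_bounds_of_slopes_in(2)[OF slope_passive[OF slopes] \<omega>] D0
    by (simp add: V_passive_def)
  ultimately show ?thesis using D1 D0 by (meson order_trans)
qed

end
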